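(* Let $m,n$ be positive integers. The number of marked binary necklaces of type $(m,n)$ equals \[ \frac{\gcd(m,n)}{m+n}\binom{m+n}{n}. \]
   Context: A binary word of type $(m,n)$ is a string of length $m+n$ over the alphabet $\{\circ,\bullet\}$ with $m$ occurrences of $\circ$ and $n$ occurrences of $\bullet$; a binary necklace of type $(m,n)$ is an equivalence class of such words under cyclic rotation. Order words lexicographically with $\circ\prec\bullet$, and for a necklace $\omega$ let $s(\omega)$ be the lexicographically minimal word representing $\omega$. Let $g=\frac{m+n}{\gcd(m,n)}$. A block of $\omega$ is a run of $g$ consecutive beads of the necklace whose counterpart in $s(\omega)$ starts at a position congruent to $1$ modulo $g$; thus $s(\omega)$ is cut into $\gcd(m,n)$ blocks. The rotational symmetry group of $\omega$ (the rotations of the $m+n$ positions fixing $\omega$) permutes these blocks; a distinguishable block is an orbit of blocks under this group (i.e. blocks are identified when some rotational symmetry of the necklace maps one to the other). A marked necklace of type $(m,n)$ is a pair consisting of a binary necklace of type $(m,n)$ together with a choice of one distinguishable block. *)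

theory Defs
  imports Complex_Main "HOL-Library.List_Lexorder"
begin

text \<open>
  Words are Boolean lists: \<^const>\<open>False\<close> is the white bead and \<^const>\<open>True\<close> the black one. The
  order on \<^typ>\<open>bool list\<close> is the lexicographic one, with \<^prop>\<open>False < True\<close>.
\<close>

definition binary_words :: "nat \<Rightarrow> nat \<Rightarrow> bool list set" where
  "binary_words m n = {w. count_list w False = m \<and> count_list w True = n}"

definition rotation_rel :: "nat \<Rightarrow> nat \<Rightarrow> (bool list \<times> bool list) set" where
  "rotation_rel m n =
     {(u, v). u \<in> binary_words m n \<and> v \<in> binary_words m n \<and> (\<exists>k. v = rotate k u)}"

definition necklaces :: "nat \<Rightarrow> nat \<Rightarrow> bool list set set" where
  "necklaces m n = binary_words m n // rotation_rel m n"

definition min_word :: "bool list set \<Rightarrow> bool list" where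
  "min_word \<omega> = Min \<omega>"

definition block_length :: "nat \<Rightarrow> nat \<Rightarrow> nat" where
  "block_length m n = (m + n) div gcd m n"

text \<open>
  The beads of a necklace \<open>\<omega>\<close> are identified with the positions \<open>0, \<dots>, m + n - 1\<close> of
  \<open>min_word \<omega>\<close>, and a block with the set of positions it occupies; in this encoding the set
  of blocks depends on \<open>m\<close> and \<open>n\<close> only. Positions count from 0, so the blocks start
  at the positions congruent to 0 (not 1) modulo the block length.
\<close>

definition blocks :: "nat \<Rightarrow> nat \<Rightarrow> nat set set" where
  "blocks m n =
     {{i..<i + block_length m n} | i. i < m + n \<and> i mod block_length m n = 0}"

text \<open>
  \<open>rotate r w ! i\<close> is \<open>w ! ((i + r) mod length w)\<close>, so the rotation of the positions by \<open>r\<close>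
  preserves the colours of \<open>w\<close> iff \<open>rotate r w = w\<close>.
\<close>

definition symmetries :: "bool list set \<Rightarrow> (nat \<Rightarrow> nat) set" where
  "symmetries \<omega> =
     {\<lambda>i. (i + r) mod length (min_word \<omega>) | r.
        r < length (min_word \<omega>) \<and> rotate r (min_word \<omega>) = min_word \<omega>}"

definition block_orbit :: "bool list set \<Rightarrow> nat set \<Rightarrow> nat set set" where
  "block_orbit \<omega> B = {\<sigma> ` B | \<sigma>. \<sigma> \<in> symmetries \<omega>}"

definition distinguishable_blocks :: "nat \<Rightarrow> nat \<Rightarrow> bool list set \<Rightarrow> nat set set set" where
  "distinguishable_blocks m n \<omega> = {block_orbit \<omega> B | B. B \<in> blocks m n}"

definition marked_necklaces :: "nat \<Rightarrow> nat \<Rightarrow> (bool list set \<times> nat set set) set" where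
  "marked_necklaces m n = (SIGMA \<omega> : necklaces m n. distinguishable_blocks m n \<omega>)"

end

theory Submission imports Defs begin

text \<open>
  Let \<open>p\<close> be the least positive rotation fixing a word of the necklace \<open>\<omega>\<close>. Then \<open>\<omega>\<close>
  has \<open>p\<close> representatives, and both letter counts are divisible by \<open>(m + n) / p\<close>, so the block
  length \<open>g\<close> divides \<open>p\<close>. Two blocks are identified iff their starting positions agree modulo
  \<open>p\<close>, which leaves \<open>p / g\<close> distinguishable blocks. Summed over all necklaces, the marked
  necklaces are thus \<open>1 / g\<close> times as many as the words.
\<close>

section \<open>Letter counts and rotations of words\<close>

lemma length_eq_count_list_bool: "length w = count_list w False + count_list w True"
  by (induction w) auto

lemma count_list_rotate [simp]: "count_list (rotate k w) x = count_list w x"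
proof (induction k)
  case (Suc k)
  have "count_list (rotate1 u) x = count_list u x" for u by (cases u) auto
  then show ?case using Suc by simp
qed simp

lemma rotate_left_cancel: "rotate k u = rotate k v \<longleftrightarrow> u = v"
  by (induction k) (simp_all add: inj_eq[OF inj_rotate1])

lemma rotate_back: "\<exists>j. rotate j (rotate k w) = w"
proof (cases "w = []")
  case False
  \<comment> \<open>Rotation by any multiple of the length is the identity; this multiple is at
    least \<open>k\<close>, so the subtraction below does not truncate.\<close>
  then have "k \<le> k * length w" by (cases w) auto
  then have "rotate (k * length w - k) (rotate k w) = rotate (k * length w) w"
    by (simp add: rotate_rotate)
  also have "\<dots> = w" by (simp add: rotate_id)
  finally show ?thesis by blast
qed simp

text \<open>Commuting words are powers of a common word. Here the length condition makes
  \<open>v\<close> the \<open>k\<close>-th power of \<open>u\<close>: each induction step strips one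
  copy of \<open>u\<close> from the front of \<open>v\<close>, and the rest still commutes with
  \<open>u\<close>.\<close>

lemma commuting_count_list:
  assumes "u @ v = v @ u" and "length v = k * length u"
  shows "count_list v x = k * count_list u x"
  using assms
proof (induction k arbitrary: v)
  case (Suc k)
  define v' where "v' = drop (length u) v"
  have "take (length u) (u @ v) = take (length u) (v @ u)" using Suc.prems(1) by simp
  then have "take (length u) v = u" using Suc.prems(2) by simp
  then have v: "v = u @ v'" unfolding v'_def by (metis append_take_drop_id)
  have "u @ v' = v' @ u" using Suc.prems(1) by (simp add: v)
  moreover have "length v' = k * length u" using Suc.prems(2) by (simp add: v)
  ultimately show ?case using Suc.IH[of v'] by (simp add: v)
qed simp

section \<open>The cyclic period of a word\<close>

text \<open>This is the period of the word read cyclically, so it always divides the length; the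
  empty word gets period 1.\<close>

definition period :: "'a list \<Rightarrow> nat" where
  "period w = (LEAST p. 0 < p \<and> rotate p w = w)"

lemma period_pos: "0 < period w" and rotate_period: "rotate (period w) w = w"
proof -
  have "\<exists>p. 0 < p \<and> rotate p w = w"
    by (cases "w = []") (auto intro: exI[of _ "length w"])
  from LeastI_ex[OF this] show "0 < period w" "rotate (period w) w = w"
    unfolding period_def by auto
qed

lemma rotate_period_mult: "rotate (k * period w) w = w"
  by (induction k) (simp_all add: rotate_rotate[symmetric] rotate_period)

lemma rotate_mod_period: "rotate (k mod period w) w = rotate k w"
proof -
  have "rotate k w = rotate (k mod period w) (rotate (k div period w * period w) w)"
    by (simp add: rotate_rotate)
  then show ?thesis by (simp add: rotate_period_mult)
qed

lemma rotate_eq_self_iff: "rotate k w = w \<longleftrightarrow> period w dvd k"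
proof
  assume "rotate k w = w"
  then have fixed: "rotate (k mod period w) w = w" by (simp add: rotate_mod_period)
  have "k mod period w < period w" by (simp add: period_pos)
  then have "\<not> (0 < k mod period w \<and> rotate (k mod period w) w = w)"
    unfolding period_def by (rule not_less_Least)
  then show "period w dvd k" using fixed by auto
qed (auto simp: dvd_def mult.commute rotate_period_mult)

text \<open>Only \<open>k mod period w\<close> matters. If two residues gave the same rotation,
  cancelling the smaller one would leave a positive rotation below the period that fixes
  \<open>w\<close>.\<close>

lemma card_rotations: "card (range (\<lambda>k. rotate k w)) = period w"
proof -
  have "range (\<lambda>k. rotate k w) = (\<lambda>k. rotate k w) ` {..<period w}"
  proof (intro equalityI image_subsetI)
    fix k
    have "k mod period w < period w" by (simp add: period_pos)
    then show "rotate k w \<in> (\<lambda>k. rotate k w) ` {..<period w}"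
      by (intro image_eqI[of _ _ "k mod period w"]) (simp_all add: rotate_mod_period)
  qed auto
  moreover have "inj_on (\<lambda>k. rotate k w) {..<period w}"
  proof (rule linorder_inj_onI)
    fix i j assume ij: "i < j" "i \<in> {..<period w}" "j \<in> {..<period w}"
    then have "\<not> period w dvd j - i" by (auto dest: dvd_imp_le)
    then have "rotate (j - i) w \<noteq> w" by (simp add: rotate_eq_self_iff)
    then have "rotate i (rotate (j - i) w) \<noteq> rotate i w" by (simp add: rotate_left_cancel)
    then show "rotate i w \<noteq> rotate j w" using ij by (simp add: rotate_rotate)
  qed auto
  ultimately show ?thesis by (simp add: card_image)
qed

lemma period_dvd_length: "period w dvd length w"
  by (simp flip: rotate_eq_self_iff)

text \<open>Let \<open>u\<close> be the first \<open>period w\<close> letters and \<open>v\<close>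
  the rest. Invariance under rotation by the period says that \<open>u\<close> and \<open>v\<close>
  commute, so \<open>w\<close> is a power of \<open>u\<close> with exponent
  \<open>length w div period w\<close>.\<close>

lemma length_div_period_dvd_count_list: "length w div period w dvd count_list w x"
proof (cases "w = []")
  case False
  define u where "u = take (period w) w"
  define v where "v = drop (period w) w"
  define q where "q = length w div period w"
  have len: "length w = q * period w" using period_dvd_length[of w] by (simp add: q_def)
  have q: "q > 0" using False len by (cases q) auto
  then have le: "period w \<le> length w" using len by (cases q) auto
  have w: "w = u @ v" by (simp add: u_def v_def)
  have lu: "length u = period w" using le by (simp add: u_def)
  have "rotate (length u) (u @ v) = u @ v" using rotate_period[of w] w lu by simp
  then have "u @ v = v @ u" by (simp add: rotate_append)
  moreover have "length v = (q - 1) * length u"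
    using len lu by (simp add: v_def diff_mult_distrib)
  ultimately have "count_list v x = (q - 1) * count_list u x"
    by (rule commuting_count_list)
  then have "count_list w x = q * count_list u x" using q by (cases q) (simp_all add: w)
  then show ?thesis by (simp add: q_def)
qed simp

section \<open>Counting binary words\<close>

lemma binary_words_Suc_Suc:
  "binary_words (Suc m) (Suc n) =
     (#) False ` binary_words m (Suc n) \<union> (#) True ` binary_words (Suc m) n"
proof -
  have "w \<in> binary_words (Suc m) (Suc n) \<longleftrightarrow>
      w \<in> (#) False ` binary_words m (Suc n) \<union> (#) True ` binary_words (Suc m) n" for w
    by (cases w; cases "hd w") (auto simp: binary_words_def)
  then show ?thesis by blast
qed

lemma finite_binary_words: "finite (binary_words m n)"
proof (rule finite_subset)
  show "binary_words m n \<subseteq> {w. set w \<subseteq> UNIV \<and> length w = m + n}"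
    by (auto simp: binary_words_def length_eq_count_list_bool)
qed (rule finite_lists_length_eq, simp)

lemma count_list_replicate_self [simp]: "count_list (replicate k x) x = k"
  by (induction k) auto

lemma binary_words_eq_replicate:
  "binary_words m 0 = {replicate m False}" "binary_words 0 n = {replicate n True}"
proof -
  \<comment> \<open>Keeping the missing letter \<open>b\<close> variable lets one induction serve
    both boundary cases.\<close>
  have "w = replicate (count_list w (\<not> b)) (\<not> b)" if "count_list w b = 0" for w b
    using that by (induction w) (auto split: if_splits)
  from this[of _ True] this[of _ False]
  show "binary_words m 0 = {replicate m False}" "binary_words 0 n = {replicate n True}"
    by (auto simp: binary_words_def count_list_0_iff)
qed

text \<open>Splitting by the first letter yields Pascal's rule; the words with only one letter give
  the boundary values.\<close>

lemma card_binary_words: "card (binary_words m n) = (m + n) choose n"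
proof (induction "m + n" arbitrary: m n)
  case (Suc N)
  show ?case
  proof (cases m; cases n)
    fix m' n' assume mn: "m = Suc m'" "n = Suc n'"
    have "card (binary_words m n) =
        card (binary_words m' (Suc n')) + card (binary_words (Suc m') n')"
      unfolding mn binary_words_Suc_Suc
      by (subst card_Un_disjoint) (auto simp: finite_binary_words card_image)
    then show ?thesis using Suc.hyps by (simp add: mn)
  qed (simp_all add: binary_words_eq_replicate)
qed (simp add: binary_words_eq_replicate)

section \<open>Necklaces as rotation classes\<close>

lemma equiv_rotation_rel: "equiv (binary_words m n) (rotation_rel m n)"
proof (rule equivI)
  show "rotation_rel m n \<subseteq> binary_words m n \<times> binary_words m n"
    by (auto simp: rotation_rel_def)
  show "refl_on (binary_words m n) (rotation_rel m n)"
    by (auto simp: refl_on_def rotation_rel_def intro: exI[of _ 0])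
  show "sym (rotation_rel m n)"
  proof (rule symI)
    fix u v assume uv: "(u, v) \<in> rotation_rel m n"
    then obtain k where "v = rotate k u" by (auto simp: rotation_rel_def)
    then obtain j where "u = rotate j v" using rotate_back[of k u] by metis
    then show "(v, u) \<in> rotation_rel m n" using uv by (auto simp: rotation_rel_def)
  qed
  show "trans (rotation_rel m n)"
    by (auto simp: trans_def rotation_rel_def rotate_rotate)
qed

lemma rotation_class:
  assumes "w \<in> binary_words m n"
  shows "rotation_rel m n `` {w} = range (\<lambda>k. rotate k w)"
  using assms by (auto simp: rotation_rel_def binary_words_def)

lemma min_word_in_necklace:
  assumes "\<omega> \<in> necklaces m n"
  shows "min_word \<omega> \<in> \<omega>"
proof -
  have "\<omega> \<subseteq> binary_words m n" "\<omega> \<noteq> {}"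
    using assms in_quotient_imp_subset[OF equiv_rotation_rel]
      in_quotient_imp_non_empty[OF equiv_rotation_rel] by (auto simp: necklaces_def)
  then show ?thesis
    unfolding min_word_def using Min_in[OF finite_subset[OF _ finite_binary_words]] by blast
qed

text \<open>A class is generated by any of its members, in particular by
  \<open>min_word \<omega>\<close>. With \<open>card_rotations\<close> this makes the size of
  \<open>\<omega>\<close> the period of \<open>min_word \<omega>\<close>.\<close>

lemma necklace_eq_rotations:
  assumes "\<omega> \<in> necklaces m n"
  shows "min_word \<omega> \<in> binary_words m n" and "\<omega> = range (\<lambda>k. rotate k (min_word \<omega>))"
proof -
  show w: "min_word \<omega> \<in> binary_words m n"
    using assms min_word_in_necklace[OF assms] in_quotient_imp_subset[OF equiv_rotation_rel]
    by (auto simp: necklaces_def)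
  obtain v where "v \<in> binary_words m n" "\<omega> = rotation_rel m n `` {v}"
    using assms by (auto simp: necklaces_def elim: quotientE)
  then have "\<omega> = rotation_rel m n `` {min_word \<omega>}"
    using min_word_in_necklace[OF assms] equiv_class_eq[OF equiv_rotation_rel] by blast
  then show "\<omega> = range (\<lambda>k. rotate k (min_word \<omega>))" using rotation_class[OF w] by simp
qed

section \<open>Block length, symmetries and orbits of blocks\<close>

lemma block_length_mult_gcd: "block_length m n * gcd m n = m + n"
  unfolding block_length_def by (rule dvd_div_mult_self) simp

lemma block_length_dvd_period:
  assumes "w \<in> binary_words m n" "m + n > 0"
  shows "block_length m n dvd period w"
proof -
  have len: "length w = m + n"
    using assms by (simp add: binary_words_def length_eq_count_list_bool)
  define q where "q = (m + n) div period w"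
  have N: "m + n = q * period w" using period_dvd_length[of w] by (simp add: q_def len)
  have "q dvd gcd m n"
    using length_div_period_dvd_count_list[of w False] length_div_period_dvd_count_list[of w True]
      assms by (simp add: q_def len binary_words_def)
  then obtain e where e: "gcd m n = q * e" by (elim dvdE)
  have "m + n = block_length m n * gcd m n" by (simp only: block_length_mult_gcd)
  \<comment> \<open>Two factorizations of \<open>m + n\<close> share the factor \<open>q\<close>;
    cancelling it exhibits the period as \<open>e\<close> block lengths.\<close>
  then have "q * period w = q * (block_length m n * e)" using N e by (simp only: mult_ac)
  moreover have "q \<noteq> 0" using N assms(2) by (cases q) auto
  ultimately show ?thesis by simp
qed

text \<open>The start of a block is a multiple of \<open>g\<close>, so rotating a block never wraps around the end.\<close>

lemma rotate_block:
  fixes a g r N :: nat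
  assumes "g dvd N" "g dvd a" "g dvd r" "N > 0"
  shows "(\<lambda>i. (i + r) mod N) ` {a..<a + g} = {(a + r) mod N..<(a + r) mod N + g}"
proof -
  define b where "b = (a + r) mod N"
  have "g dvd b" using assms by (simp add: b_def dvd_mod)
  moreover have "b < N" using assms by (simp add: b_def)
  \<comment> \<open>\<open>N - b\<close> is a positive multiple of \<open>g\<close>, hence at least
    \<open>g\<close>.\<close>
  ultimately have le: "b + g \<le> N"
    using assms(1) by (metis dvd_diff_nat dvd_imp_le le_diff_conv2 less_imp_le zero_less_diff add.commute)
  have step: "(a + t + r) mod N = b + t" if "t < g" for t
  proof -
    have "a + t + r = a + r + t" by simp
    then have "(a + t + r) mod N = (b + t) mod N" by (simp only: b_def mod_add_left_eq)
    then show ?thesis using that le by simp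
  qed
  have "(\<lambda>i. (i + r) mod N) ` {a..<a + g} = (\<lambda>i. (i + r) mod N) ` (+) a ` {0..<g}"
    by (simp add: add.commute)
  also have "\<dots> = (+) b ` {0..<g}"
    unfolding image_image by (rule image_cong) (simp_all add: step)
  also have "\<dots> = {b..<b + g}" by (simp add: add.commute)
  finally show ?thesis by (simp only: b_def)
qed

text \<open>The multiples of \<open>p\<close> form a subgroup of the integers modulo
  \<open>N\<close>, and its cosets are the residue classes modulo \<open>p\<close>.\<close>

lemma mod_eq_iff_shift:
  fixes a b p N :: nat
  assumes "p dvd N" "a < N" "b < N"
  shows "b mod p = a mod p \<longleftrightarrow> (\<exists>r<N. p dvd r \<and> b = (a + r) mod N)"
proof
  assume eq: "b mod p = a mod p"
  \<comment> \<open>This is \<open>b - a\<close> modulo \<open>N\<close>, with \<open>N\<close>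
    added first to stay within the naturals.\<close>
  define r where "r = (b + (N - a)) mod N"
  have "(a + r) mod N = (b + N) mod N" using assms by (simp add: r_def mod_add_right_eq)
  moreover have "p dvd r"
  proof -
    have "int p dvd int b - int a" using eq by (metis mod_eq_dvd_iff of_nat_mod)
    then have "int p dvd int b - int a + int N" using assms(1) by simp
    moreover have "int b - int a + int N = int (b + (N - a))" using assms by simp
    ultimately have "p dvd b + (N - a)" by (metis int_dvd_int_iff)
    then show ?thesis using assms(1) by (simp add: r_def dvd_mod)
  qed
  ultimately show "\<exists>r<N. p dvd r \<and> b = (a + r) mod N"
    using assms by (intro exI[of _ r]) (simp add: r_def)
next
  assume "\<exists>r<N. p dvd r \<and> b = (a + r) mod N"
  then show "b mod p = a mod p" using assms(1) by (auto simp: mod_mod_cancel)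
qed

text \<open>The symmetries are the rotations by multiples of the period, and each sends a block to
  the block at the shifted start. Every \<open>b\<close> on the right is a multiple of the block
  length, which divides both \<open>a\<close> and the period. The right side depends on
  \<open>a\<close> only through its residue, so residues can index the orbits.\<close>

lemma block_orbit_eq:
  assumes "\<omega> \<in> necklaces m n" "m + n > 0" "a < m + n" "block_length m n dvd a"
  shows "block_orbit \<omega> {a..<a + block_length m n} =
    (\<lambda>b. {b..<b + block_length m n}) ` {b. b < m + n \<and> b mod period (min_word \<omega>) = a mod period (min_word \<omega>)}"
proof -
  define w where "w = min_word \<omega>"
  define g where "g = block_length m n"
  have w: "w \<in> binary_words m n" using necklace_eq_rotations[OF assms(1)] by (simp add: w_def)
  then have len: "length w = m + n" by (simp add: binary_words_def length_eq_count_list_bool)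
  have p: "period w dvd m + n" using period_dvd_length[of w] len by simp
  have g: "g dvd period w" using block_length_dvd_period[OF w assms(2)] by (simp add: g_def)
  have "block_orbit \<omega> {a..<a + g} =
      (\<lambda>r. (\<lambda>i. (i + r) mod (m + n)) ` {a..<a + g}) ` {r. r < m + n \<and> period w dvd r}"
    by (auto simp: block_orbit_def symmetries_def len rotate_eq_self_iff simp flip: w_def)
  also have "\<dots> = (\<lambda>r. {(a + r) mod (m + n)..<(a + r) mod (m + n) + g}) ` {r. r < m + n \<and> period w dvd r}"
    using assms g p by (intro image_cong refl rotate_block) (auto simp: g_def intro: dvd_trans)
  also have "\<dots> = (\<lambda>b. {b..<b + g}) ` (\<lambda>r. (a + r) mod (m + n)) ` {r. r < m + n \<and> period w dvd r}"
    by (simp add: image_image)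
  also have "(\<lambda>r. (a + r) mod (m + n)) ` {r. r < m + n \<and> period w dvd r} =
      {b. b < m + n \<and> b mod period w = a mod period w}"
  proof (intro set_eqI iffI)
    fix b assume "b \<in> {b. b < m + n \<and> b mod period w = a mod period w}"
    then obtain r where "r < m + n" "period w dvd r" "b = (a + r) mod (m + n)"
      using mod_eq_iff_shift[OF p assms(3)] by auto
    then show "b \<in> (\<lambda>r. (a + r) mod (m + n)) ` {r. r < m + n \<and> period w dvd r}" by blast
  next
    fix b assume "b \<in> (\<lambda>r. (a + r) mod (m + n)) ` {r. r < m + n \<and> period w dvd r}"
    then obtain r where r: "r < m + n" "period w dvd r" "b = (a + r) mod (m + n)" by blast
    then have "b < m + n" using assms(2) by simp
    then show "b \<in> {b. b < m + n \<and> b mod period w = a mod period w}"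
      using mod_eq_iff_shift[OF p assms(3)] r by blast
  qed
  finally show ?thesis by (simp add: g_def w_def)
qed

lemma card_multiples_below:
  fixes g p :: nat
  assumes "g dvd p" "g > 0"
  shows "card {c. c < p \<and> g dvd c} = p div g"
proof -
  obtain e where p: "p = g * e" using assms(1) by (rule dvdE)
  have "{c. c < p \<and> g dvd c} = (*) g ` {..<e}"
  proof (intro equalityI subsetI)
    fix c assume c: "c \<in> {c. c < p \<and> g dvd c}"
    then obtain j where "c = g * j" by (auto elim: dvdE)
    then show "c \<in> (*) g ` {..<e}" using c assms(2) by (simp add: p)
  qed (use assms(2) in \<open>auto simp: p\<close>)
  then show ?thesis using assms(2) by (simp add: p card_image inj_on_def)
qed

text \<open>Orbits correspond to the multiples of \<open>g\<close> below \<open>p\<close>, and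
  \<open>\<omega>\<close> has \<open>p\<close> elements. The product form avoids a quotient that
  varies with the necklace in the final sum.\<close>

lemma card_distinguishable_blocks:
  assumes "\<omega> \<in> necklaces m n" "m + n > 0"
  shows "block_length m n * card (distinguishable_blocks m n \<omega>) = card \<omega>"
proof -
  define p where "p = period (min_word \<omega>)"
  define g where "g = block_length m n"
  define C where "C c = (\<lambda>b. {b..<b + g}) ` {b. b < m + n \<and> b mod p = c}" for c
  have w: "min_word \<omega> \<in> binary_words m n"
    and card: "card \<omega> = p"
    using necklace_eq_rotations[OF assms(1)] card_rotations[of "min_word \<omega>"] by (auto simp: p_def)
  have len: "length (min_word \<omega>) = m + n"
    using w by (simp add: binary_words_def length_eq_count_list_bool)
  have pN: "p dvd m + n" using period_dvd_length[of "min_word \<omega>"] by (simp add: p_def len)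
  have gp: "g dvd p" using block_length_dvd_period[OF w assms(2)] by (simp add: p_def g_def)
  have p0: "p > 0" by (simp add: p_def period_pos)
  have g0: "g > 0" using gp p0 by (cases g) auto
  have pleN: "p \<le> m + n" using pN assms(2) by (rule dvd_imp_le)
  have "blocks m n = (\<lambda>a. {a..<a + g}) ` {a. a < m + n \<and> g dvd a}"
    by (simp only: blocks_def g_def dvd_eq_mod_eq_0 setcompr_eq_image)
  then have "distinguishable_blocks m n \<omega> = (\<lambda>a. block_orbit \<omega> {a..<a + g}) ` {a. a < m + n \<and> g dvd a}"
    by (simp only: distinguishable_blocks_def setcompr_eq_image Collect_mem_eq image_image)
  also have "\<dots> = (\<lambda>a. C (a mod p)) ` {a. a < m + n \<and> g dvd a}"
    using block_orbit_eq[OF assms] by (intro image_cong) (auto simp: C_def g_def p_def)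
  also have "\<dots> = C ` (\<lambda>a. a mod p) ` {a. a < m + n \<and> g dvd a}"
    by (simp add: image_image)
  \<comment> \<open>Reduction modulo \<open>p\<close> preserves divisibility by \<open>g\<close>
    because \<open>g\<close> divides \<open>p\<close>; conversely each \<open>c < p\<close> is its
    own residue and lies below \<open>m + n\<close>.\<close>
  also have "(\<lambda>a. a mod p) ` {a. a < m + n \<and> g dvd a} = {c. c < p \<and> g dvd c}"
  proof (intro equalityI subsetI)
    fix c assume "c \<in> (\<lambda>a. a mod p) ` {a. a < m + n \<and> g dvd a}"
    then show "c \<in> {c. c < p \<and> g dvd c}" using gp p0 by (auto intro: dvd_mod)
  next
    fix c assume "c \<in> {c. c < p \<and> g dvd c}"
    then show "c \<in> (\<lambda>a. a mod p) ` {a. a < m + n \<and> g dvd a}"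
      using pleN by (intro image_eqI[of _ _ c]) auto
  qed
  finally have D: "distinguishable_blocks m n \<omega> = C ` {c. c < p \<and> g dvd c}" .
  have "inj_on C {..<p}"
  proof (rule inj_onI)
    fix c c' assume c: "c \<in> {..<p}" "c' \<in> {..<p}" and eq: "C c = C c'"
    \<comment> \<open>The block starting at \<open>c\<close> serves as a witness: it is a nonempty
      interval, so its start, and with it the residue, can be read off.\<close>
    have "{c..<c + g} \<in> C c" using c pleN by (auto simp: C_def)
    then have "{c..<c + g} \<in> C c'" using eq by simp
    then obtain b where "{c..<c + g} = {b..<b + g}" "b mod p = c'" by (auto simp: C_def)
    moreover from this(1) have "c = b" using g0 by (intro atLeastLessThan_inj(1)) auto
    ultimately show "c = c'" using c by simp
  qed
  then have "inj_on C {c. c < p \<and> g dvd c}" by (rule inj_on_subset) auto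
  then have "card (distinguishable_blocks m n \<omega>) = card {c. c < p \<and> g dvd c}"
    unfolding D by (rule card_image)
  also have "\<dots> = p div g" using gp g0 by (rule card_multiples_below)
  finally show ?thesis using dvd_mult_div_cancel[OF gp] by (simp only: card g_def)
qed

section \<open>Summation over all necklaces\<close>

lemma finite_necklaces: "finite (necklaces m n)"
  unfolding necklaces_def
  by (rule finite_quotient[OF finite_binary_words]) (auto simp: rotation_rel_def)

text \<open>The necklaces partition the set of binary words.\<close>

lemma sum_card_necklaces: "(\<Sum>\<omega>\<in>necklaces m n. card \<omega>) = (m + n) choose n"
proof -
  have "card (\<Union> (necklaces m n)) = (\<Sum>\<omega>\<in>necklaces m n. card \<omega>)"
  proof (rule card_Union_disjoint)
    show "pairwise disjnt (necklaces m n)"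
      using quotient_disj[OF equiv_rotation_rel[of m n]]
      by (auto simp: pairwise_def disjnt_def necklaces_def)
    show "finite \<omega>" if "\<omega> \<in> necklaces m n" for \<omega>
      using in_quotient_imp_subset[OF equiv_rotation_rel that[unfolded necklaces_def]]
      by (rule finite_subset[OF _ finite_binary_words])
  qed
  then show ?thesis
    by (simp add: necklaces_def Union_quotient[OF equiv_rotation_rel] card_binary_words)
qed

theorem theorem3:
  fixes m n :: nat
  assumes "m > 0" and "n > 0"
  shows "real (card (marked_necklaces m n)) =
           real (gcd m n) / real (m + n) * real ((m + n) choose n)"
proof -
  have "finite (blocks m n)" by (simp add: blocks_def)
  then have "finite (distinguishable_blocks m n \<omega>)" for \<omega>
    by (simp add: distinguishable_blocks_def)
  then have "card (marked_necklaces m n) =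
      (\<Sum>\<omega>\<in>necklaces m n. card (distinguishable_blocks m n \<omega>))"
    by (simp add: marked_necklaces_def finite_necklaces)
  \<comment> \<open>The factor \<open>block_length m n\<close> is the same for all necklaces, so it
    moves inside the sum and turns each term into \<open>card \<omega>\<close>.\<close>
  then have "block_length m n * card (marked_necklaces m n) = (\<Sum>\<omega>\<in>necklaces m n. card \<omega>)"
    using card_distinguishable_blocks assms by (simp add: sum_distrib_left)
  then have "block_length m n * card (marked_necklaces m n) = (m + n) choose n"
    by (simp add: sum_card_necklaces)
  moreover have "m + n = gcd m n * block_length m n" by (simp only: block_length_mult_gcd mult.commute)
  ultimately have "(m + n) * card (marked_necklaces m n) = gcd m n * ((m + n) choose n)"
    by (metis mult.assoc)
  then have "real (m + n) * real (card (marked_necklaces m n)) =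
      real (gcd m n) * real ((m + n) choose n)"
    by (metis of_nat_mult)
  then show ?thesis using assms by (simp add: field_simps)
qed

end
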